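(* Let $n\ge2$. For all values of $\lambda=(\lambda_1,\lambda_2)\in\mathbb R^2$ and $\mu\in\mathbb R$ such that $\mu-\lambda_1-\lambda_2=\frac{n+3}{n+1}$, there exists no $sl_{n+1}$-equivariant symbol map defined on $\mathcal M^2_{\mathit{diff}}(\lambda,\mu)$.
   Context: Everything is smooth; $x^1,\dots,x^n$ are the coordinates of $\mathbb R^n$, $\partial_i=\partial/\partial x^i$. For $\lambda\in\mathbb R$, densities of weight $\lambda$ are sections of the trivial line bundle $\Delta^\lambda(\mathbb R^n)$, identified with functions $\phi$ with $L_X\phi=\sum_iX^i\partial_i\phi+\lambda(\sum_i\partial_iX^i)\phi$. Put $\delta=\mu-\lambda_1-\lambda_2$. $\mathcal M^2_{\mathit{diff}}(\lambda,\mu)$ is the space of bidifferential operators $T:(f,g)\mapsto\sum A_{a,b}D^afD^bg$ (finite sums, $a,b$ multi-indices) from densities of weights $\lambda_1$, $\lambda_2$ to densities of weight $\mu$; the coefficients are $\delta$-densities. Module structure: $(L_XT)(f,g)=L_X(T(f,g))-T(L_Xf,g)-T(f,L_Xg)$. The total order of $T$ is the largest $|a|+|b|$ with $A_{a,b}\neq0$. $\mathcal S^{(2)}_\delta=\bigoplus_{k,l\ge0}\Gamma(\vee^kT\mathbb R^n\otimes\vee^lT\mathbb R^n\otimes\Delta^\delta(\mathbb R^n))$, viewed as polynomials in $\alpha,\beta\in\mathbb R^{n*}$ with $\delta$-densities as coefficients, with $L_XP=\sum_iX^i\partial_iP-\sum_{i,j}(\partial_jX^i)(\alpha_iD_{\alpha_j}+\beta_iD_{\beta_j})P+\delta(\sum_i\partial_iX^i)P$.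 The polynomial form of $T$ is $\sum A_{a,b}\alpha^a\beta^b\in\mathcal S^{(2)}_\delta$; its principal symbol is the homogeneous component of highest total degree of its polynomial form. $sl_{n+1}$ is the Lie algebra of vector fields spanned by $\partial_i$, $x^j\partial_i$, $x^j\sum_ix^i\partial_i$ ($1\le i,j\le n$). An $sl_{n+1}$-equivariant symbol map is a linear bijection $\sigma:\mathcal M^2_{\mathit{diff}}(\lambda,\mu)\to\mathcal S^{(2)}_\delta$ that preserves the principal symbol (for $T$ of total order $r$, $\sigma(T)$ has degree $r$ and its homogeneous component of total degree $r$ is the principal symbol of $T$) and satisfies $\sigma(L_XT)=L_X(\sigma(T))$ for all $X\in sl_{n+1}$ and all $T$. *)

theory Defs
  imports "HOL-Analysis.Analysis" "HOL-Library.Poly_Mapping"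
begin

section \<open>Smooth functions on Euclidean space\<close>

definition partial_deriv :: "'n::finite \<Rightarrow> (real^'n \<Rightarrow> real) \<Rightarrow> real^'n \<Rightarrow> real"
  where "partial_deriv i f = (\<lambda>x. frechet_derivative f (at x) (axis i 1))"

primrec times_differentiable :: "nat \<Rightarrow> (real^'n::finite \<Rightarrow> real) \<Rightarrow> bool" where
  "times_differentiable 0 f \<longleftrightarrow> True"
| "times_differentiable (Suc k) f \<longleftrightarrow>
     (\<forall>x. f differentiable (at x)) \<and> (\<forall>i. times_differentiable k (partial_deriv i f))"

definition smooth :: "(real^'n::finite \<Rightarrow> real) \<Rightarrow> bool"
  where "smooth f \<longleftrightarrow> (\<forall>k. times_differentiable k f)"

lemma smooth_differentiable: "smooth f \<Longrightarrow> f differentiable (at x)"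
  unfolding smooth_def using times_differentiable.simps(2)[of 0 f] by blast

lemma smooth_partial_deriv: "smooth f \<Longrightarrow> smooth (partial_deriv i f)"
  unfolding smooth_def by (metis times_differentiable.simps(2))

lemma partial_deriv_eqI: "(\<And>x. (f has_derivative f' x) (at x)) \<Longrightarrow> partial_deriv i f = (\<lambda>x. f' x (axis i 1))"
  unfolding partial_deriv_def by (metis frechet_derivative_at)

lemma partial_deriv_const: "partial_deriv i (\<lambda>x. c) = (\<lambda>x. 0)"
  by (rule partial_deriv_eqI) (rule has_derivative_const)

lemma partial_deriv_coord:
  "partial_deriv i (\<lambda>x::real^'n::finite. x $ j) = (\<lambda>x. if i = j then 1 else 0)"
proof -
  have "((\<lambda>x::real^'n. x $ j) has_derivative (\<lambda>x. x $ j)) (at x)" for x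
    by (rule bounded_linear_imp_has_derivative) (rule bounded_linear_vec_nth)
  from partial_deriv_eqI[OF this] show ?thesis by (auto simp: axis_def)
qed

lemma partial_deriv_add:
  assumes "\<And>x. f differentiable (at x)" "\<And>x. g differentiable (at x)"
  shows "partial_deriv i (\<lambda>x. f x + g x) = (\<lambda>x. partial_deriv i f x + partial_deriv i g x)"
  unfolding partial_deriv_def[of i f] partial_deriv_def[of i g]
  by (rule partial_deriv_eqI) (intro has_derivative_add assms[THEN frechet_derivative_works[THEN iffD1]])

lemma partial_deriv_mult:
  assumes "\<And>x. f differentiable (at x)" "\<And>x. g differentiable (at x)"
  shows "partial_deriv i (\<lambda>x. f x * g x) = (\<lambda>x. f x * partial_deriv i g x + partial_deriv i f x * g x)"
  unfolding partial_deriv_def[of i f] partial_deriv_def[of i g]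
  by (rule partial_deriv_eqI) (intro has_derivative_mult assms[THEN frechet_derivative_works[THEN iffD1]])

lemma times_differentiable_Suc: "times_differentiable (Suc k) f \<Longrightarrow> times_differentiable k f"
  by (induction k arbitrary: f) auto

lemma times_differentiable_add:
  "times_differentiable k f \<Longrightarrow> times_differentiable k g \<Longrightarrow> times_differentiable k (\<lambda>x. f x + g x)"
  by (induction k arbitrary: f g) (auto simp: partial_deriv_add)

lemma times_differentiable_mult:
  "times_differentiable k f \<Longrightarrow> times_differentiable k g \<Longrightarrow> times_differentiable k (\<lambda>x. f x * g x)"
proof (induction k arbitrary: f g)
  case (Suc k)
  then show ?case
    using times_differentiable_Suc[OF Suc.prems(1)] times_differentiable_Suc[OF Suc.prems(2)]
    by (auto simp: partial_deriv_mult intro!: times_differentiable_add)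
qed simp

lemma smooth_const: "smooth (\<lambda>x::real^'n::finite. c)"
proof -
  have "times_differentiable k (\<lambda>x::real^'n. c)" for k c
    by (induction k arbitrary: c) (auto simp: partial_deriv_const)
  then show ?thesis by (simp add: smooth_def)
qed

lemma smooth_coord: "smooth (\<lambda>x::real^'n::finite. x $ j)"
proof -
  have "(\<lambda>x::real^'n. x $ j) differentiable (at x)" for x
    by (rule bounded_linear_imp_differentiable) (rule bounded_linear_vec_nth)
  then have "times_differentiable k (\<lambda>x::real^'n. x $ j)" for k
    using smooth_const by (cases k) (auto simp: partial_deriv_coord smooth_def)
  then show ?thesis by (simp add: smooth_def)
qed

lemma smooth_add: "smooth f \<Longrightarrow> smooth g \<Longrightarrow> smooth (\<lambda>x. f x + g x)"
  by (simp add: smooth_def times_differentiable_add)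

lemma smooth_mult: "smooth f \<Longrightarrow> smooth g \<Longrightarrow> smooth (\<lambda>x. f x * g x)"
  by (simp add: smooth_def times_differentiable_mult)

typedef (overloaded) 'n smooth_fun = "{f :: real^'n::finite \<Rightarrow> real. smooth f}"
  morphisms apply_smooth Smooth_fun
  using smooth_const by blast

setup_lifting type_definition_smooth_fun

instantiation smooth_fun :: (finite) "{comm_ring_1, real_algebra_1}"
begin

lift_definition zero_smooth_fun :: "'a smooth_fun" is "\<lambda>x. 0" by (rule smooth_const)
lift_definition one_smooth_fun :: "'a smooth_fun" is "\<lambda>x. 1" by (rule smooth_const)
lift_definition plus_smooth_fun :: "'a smooth_fun \<Rightarrow> 'a smooth_fun \<Rightarrow> 'a smooth_fun"
  is "\<lambda>f g x. f x + g x" by (rule smooth_add)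
lift_definition times_smooth_fun :: "'a smooth_fun \<Rightarrow> 'a smooth_fun \<Rightarrow> 'a smooth_fun"
  is "\<lambda>f g x. f x * g x" by (rule smooth_mult)
lift_definition scaleR_smooth_fun :: "real \<Rightarrow> 'a smooth_fun \<Rightarrow> 'a smooth_fun"
  is "\<lambda>c f x. c * f x" by (intro smooth_mult smooth_const)
lift_definition uminus_smooth_fun :: "'a smooth_fun \<Rightarrow> 'a smooth_fun" is "\<lambda>f x. - f x"
  using smooth_mult[OF smooth_const[of "-1"]] by simp
lift_definition minus_smooth_fun :: "'a smooth_fun \<Rightarrow> 'a smooth_fun \<Rightarrow> 'a smooth_fun"
  is "\<lambda>f g x. f x - g x"
  subgoal for f g
    using smooth_add[of f "\<lambda>x. (-1) * g x"] smooth_mult[OF smooth_const[of "-1"], of g] by simp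
  done

instance
  by standard (transfer; auto simp: algebra_simps fun_eq_iff)+

end

lift_definition coord :: "'n \<Rightarrow> 'n::finite smooth_fun" is "\<lambda>i x. x $ i"
  by (rule smooth_coord)

lift_definition pd :: "'n \<Rightarrow> 'n::finite smooth_fun \<Rightarrow> 'n smooth_fun" is partial_deriv
  by (rule smooth_partial_deriv)

lemma pd_add: "pd i (f + g) = pd i f + pd i g"
  by transfer (simp add: partial_deriv_add smooth_differentiable)

lemma pd_mult: "pd i (f * g) = f * pd i g + pd i f * g"
  by transfer (simp add: partial_deriv_mult smooth_differentiable)

lemma pd_scaleR: "pd i (c *\<^sub>R f) = c *\<^sub>R pd i f"
  by transfer (simp add: partial_deriv_mult smooth_differentiable smooth_const partial_deriv_const)

lemma pd_coord: "pd i (coord j) = (if i = j then 1 else 0)"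
  by transfer (auto simp: partial_deriv_coord)

lemma pd_0 [simp]: "pd i 0 = 0"
  by transfer (rule partial_deriv_const)

lemma pd_1 [simp]: "pd i 1 = 0"
  by transfer (rule partial_deriv_const)

lemma smooth_line_deriv:
  fixes f :: "real^'n::finite \<Rightarrow> real"
  assumes "smooth f"
  shows "((\<lambda>t. f (p + t *\<^sub>R axis i 1)) has_real_derivative partial_deriv i f (p + t *\<^sub>R axis i 1)) (at t)"
proof -
  let ?x = "p + t *\<^sub>R axis i 1"
  have "(f has_derivative frechet_derivative f (at ?x)) (at ?x)"
    using assms by (intro frechet_derivative_works[THEN iffD1] smooth_differentiable)
  moreover have "((\<lambda>t::real. p + t *\<^sub>R axis i 1) has_derivative (\<lambda>t. t *\<^sub>R axis i 1)) (at t)"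
    by (auto intro!: derivative_eq_intros)
  ultimately have "((\<lambda>t. f (p + t *\<^sub>R axis i 1)) has_derivative
      (\<lambda>s. frechet_derivative f (at ?x) (s *\<^sub>R axis i 1))) (at t)"
    by (rule has_derivative_compose[rotated])
  moreover have "linear (frechet_derivative f (at ?x))"
    using assms by (intro linear_frechet_derivative smooth_differentiable)
  then have "(\<lambda>s. frechet_derivative f (at ?x) (s *\<^sub>R axis i 1)) = (*) (partial_deriv i f ?x)"
    by (simp add: fun_eq_iff linear_cmul partial_deriv_def)
  ultimately show ?thesis
    by (simp add: has_field_derivative_def)
qed

lemma smooth_second_difference:
  fixes f :: "real^'n::finite \<Rightarrow> real"
  assumes f: "smooth f" and "h > 0"
  shows "\<exists>s r. 0 < s \<and> s < h \<and> 0 < r \<and> r < h \<and>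
    f (p + h *\<^sub>R axis i 1 + h *\<^sub>R axis j 1) - f (p + h *\<^sub>R axis i 1) - f (p + h *\<^sub>R axis j 1) + f p
      = h * h * partial_deriv j (partial_deriv i f) (p + s *\<^sub>R axis i 1 + r *\<^sub>R axis j 1)"
proof -
  let ?ei = "axis i 1 :: real^'n" and ?ej = "axis j 1 :: real^'n"
  let ?u = "\<lambda>t. f ((p + h *\<^sub>R ?ej) + t *\<^sub>R ?ei) - f (p + t *\<^sub>R ?ei)"
  have "\<exists>s. 0 < s \<and> s < h \<and> ?u h - ?u 0 = (h - 0) *
     (partial_deriv i f ((p + h *\<^sub>R ?ej) + s *\<^sub>R ?ei) - partial_deriv i f (p + s *\<^sub>R ?ei))"
    by (rule MVT2[OF \<open>h > 0\<close>]) (intro DERIV_diff smooth_line_deriv f)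
  then obtain s where s: "0 < s" "s < h" "?u h - ?u 0 = h *
     (partial_deriv i f ((p + h *\<^sub>R ?ej) + s *\<^sub>R ?ei) - partial_deriv i f (p + s *\<^sub>R ?ei))"
    by auto
  let ?v = "\<lambda>t. partial_deriv i f ((p + s *\<^sub>R ?ei) + t *\<^sub>R ?ej)"
  have "\<exists>r. 0 < r \<and> r < h \<and> ?v h - ?v 0 = (h - 0) *
     partial_deriv j (partial_deriv i f) ((p + s *\<^sub>R ?ei) + r *\<^sub>R ?ej)"
    by (rule MVT2[OF \<open>h > 0\<close>]) (intro smooth_line_deriv smooth_partial_deriv f)
  then obtain r where r: "0 < r" "r < h" "?v h - ?v 0 =
     h * partial_deriv j (partial_deriv i f) ((p + s *\<^sub>R ?ei) + r *\<^sub>R ?ej)"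
    by auto
  show ?thesis using s r by (intro exI[of _ s] exI[of _ r]) (simp add: algebra_simps)
qed

lemma partial_deriv_commute:
  fixes f :: "real^'n::finite \<Rightarrow> real"
  assumes f: "smooth f"
  shows "partial_deriv i (partial_deriv j f) = partial_deriv j (partial_deriv i f)"
proof
  fix p :: "real^'n"
  let ?ei = "axis i 1 :: real^'n" and ?ej = "axis j 1 :: real^'n"
  let ?A = "partial_deriv i (partial_deriv j f)" and ?B = "partial_deriv j (partial_deriv i f)"
  have ex: "\<exists>s r s' r'. 0 < s \<and> s < h \<and> 0 < r \<and> r < h \<and> 0 < s' \<and> s' < h \<and> 0 < r' \<and> r' < h \<and>
      ?B (p + s *\<^sub>R ?ei + r *\<^sub>R ?ej) = ?A (p + s' *\<^sub>R ?ej + r' *\<^sub>R ?ei)" if h: "h > 0" for h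
  proof -
    obtain s r where 1: "0 < s" "s < h" "0 < r" "r < h"
      "f (p + h *\<^sub>R ?ei + h *\<^sub>R ?ej) - f (p + h *\<^sub>R ?ei) - f (p + h *\<^sub>R ?ej) + f p
        = h * h * ?B (p + s *\<^sub>R ?ei + r *\<^sub>R ?ej)"
      using smooth_second_difference[OF f h, of p i j] by blast
    obtain s' r' where 2: "0 < s'" "s' < h" "0 < r'" "r' < h"
      "f (p + h *\<^sub>R ?ej + h *\<^sub>R ?ei) - f (p + h *\<^sub>R ?ej) - f (p + h *\<^sub>R ?ei) + f p
        = h * h * ?A (p + s' *\<^sub>R ?ej + r' *\<^sub>R ?ei)"
      using smooth_second_difference[OF f h, of p j i] by blast
    have swap: "p + h *\<^sub>R ?ej + h *\<^sub>R ?ei = p + h *\<^sub>R ?ei + h *\<^sub>R ?ej"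
      by (simp only: ac_simps)
    have "u = v" if "x - a - b + c = h * h * u" "x - b - a + c = h * h * v" for x a b c u v :: real
    proof -
      have "h * h * u = h * h * v" using that by linarith
      with h show ?thesis by simp
    qed
    from this[OF 1(5) 2(5)[unfolded swap]]
    have "?B (p + s *\<^sub>R ?ei + r *\<^sub>R ?ej) = ?A (p + s' *\<^sub>R ?ej + r' *\<^sub>R ?ei)" .
    with 1 2 show ?thesis by blast
  qed
  define h where "h = (\<lambda>k. inverse (real (Suc k)))"
  have "\<forall>k. \<exists>s r s' r'. 0 < s \<and> s < h k \<and> 0 < r \<and> r < h k \<and> 0 < s' \<and> s' < h k \<and> 0 < r' \<and> r' < h k \<and>
      ?B (p + s *\<^sub>R ?ei + r *\<^sub>R ?ej) = ?A (p + s' *\<^sub>R ?ej + r' *\<^sub>R ?ei)"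
    using ex by (auto simp: h_def)
  then obtain s r s' r' where srs: "\<And>k. 0 < s k \<and> s k < h k \<and> 0 < r k \<and> r k < h k \<and>
      0 < s' k \<and> s' k < h k \<and> 0 < r' k \<and> r' k < h k \<and>
      ?B (p + s k *\<^sub>R ?ei + r k *\<^sub>R ?ej) = ?A (p + s' k *\<^sub>R ?ej + r' k *\<^sub>R ?ei)"
    by metis
  have h0: "h \<longlonglongrightarrow> 0" unfolding h_def by (rule LIMSEQ_inverse_real_of_nat)
  have t0: "u \<longlonglongrightarrow> 0" if "\<And>k. 0 < u k \<and> u k < h k" for u
    by (rule tendsto_sandwich[OF _ _ tendsto_const h0])
       (use that in \<open>auto intro!: always_eventually less_imp_le\<close>)
  have lims: "s \<longlonglongrightarrow> 0" "r \<longlonglongrightarrow> 0" "s' \<longlonglongrightarrow> 0" "r' \<longlonglongrightarrow> 0"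
    using srs by (auto intro!: t0)
  have cont: "isCont ?A p" "isCont ?B p"
    by (intro differentiable_imp_continuous_within smooth_differentiable smooth_partial_deriv f)+
  have "(\<lambda>k. p + s k *\<^sub>R ?ei + r k *\<^sub>R ?ej) \<longlonglongrightarrow> p + 0 *\<^sub>R ?ei + 0 *\<^sub>R ?ej"
    by (intro tendsto_intros lims)
  then have B: "(\<lambda>k. ?B (p + s k *\<^sub>R ?ei + r k *\<^sub>R ?ej)) \<longlonglongrightarrow> ?B p"
    using cont(2) by (auto intro: isCont_tendsto_compose)
  have "(\<lambda>k. p + s' k *\<^sub>R ?ej + r' k *\<^sub>R ?ei) \<longlonglongrightarrow> p + 0 *\<^sub>R ?ej + 0 *\<^sub>R ?ei"
    by (intro tendsto_intros lims)
  then have A: "(\<lambda>k. ?A (p + s' k *\<^sub>R ?ej + r' k *\<^sub>R ?ei)) \<longlonglongrightarrow> ?A p"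
    using cont(1) by (auto intro: isCont_tendsto_compose)
  have "(\<lambda>k. ?B (p + s k *\<^sub>R ?ei + r k *\<^sub>R ?ej)) = (\<lambda>k. ?A (p + s' k *\<^sub>R ?ej + r' k *\<^sub>R ?ei))"
    using srs by blast
  from LIMSEQ_unique[OF A B[unfolded this]] show "?A p = ?B p" .
qed

lemma pd_commute: "pd i (pd j f) = pd j (pd i f)"
  by transfer (rule partial_deriv_commute)


section \<open>Densities and vector fields\<close>

text \<open>Densities of any weight are identified with functions; the weight only enters the
  Lie derivative.\<close>

type_synonym 'n vector_field = "'n smooth_fun ^ 'n"

definition divergence :: "'n::finite vector_field \<Rightarrow> 'n smooth_fun"
  where "divergence X = (\<Sum>i\<in>UNIV. pd i (X $ i))"

definition lie_density :: "real \<Rightarrow> 'n::finite vector_field \<Rightarrow> 'n smooth_fun \<Rightarrow> 'n smooth_fun"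
  where "lie_density w X \<phi> = (\<Sum>i\<in>UNIV. X $ i * pd i \<phi>) + w *\<^sub>R (divergence X * \<phi>)"

definition sl_fields :: "'n::finite vector_field set"
  where "sl_fields = span ({axis i 1 | i. True} \<union> {axis i (coord j) | i j. True}
                           \<union> {\<chi> i. coord j * coord i | j. True})"


section \<open>Symbols\<close>

type_synonym 'n multi_index = "'n \<Rightarrow>\<^sub>0 nat"

text \<open>The monomial \<open>\<alpha>\<^sup>a \<beta>\<^sup>b\<close> is encoded by the pair \<open>(a, b)\<close>; since pairs of multi-indices form
  an additive monoid, the type below is the polynomial ring in \<open>\<alpha>, \<beta>\<close>
  over the smooth functions.\<close>

type_synonym 'n symbol = "('n multi_index \<times> 'n multi_index) \<Rightarrow>\<^sub>0 'n smooth_fun"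

definition var_alpha :: "'n::finite \<Rightarrow> 'n symbol"
  where "var_alpha i = Poly_Mapping.single (Poly_Mapping.single i 1, 0) 1"

definition var_beta :: "'n::finite \<Rightarrow> 'n symbol"
  where "var_beta i = Poly_Mapping.single (0, Poly_Mapping.single i 1) 1"

definition coeff_symbol :: "'n::finite smooth_fun \<Rightarrow> 'n symbol"
  where "coeff_symbol c = Poly_Mapping.single 0 c"

definition scale_symbol :: "real \<Rightarrow> 'n::finite symbol \<Rightarrow> 'n symbol"
  where "scale_symbol c P = Poly_Mapping.map (\<lambda>u. c *\<^sub>R u) P"

definition deriv_coeffs :: "'n::finite \<Rightarrow> 'n symbol \<Rightarrow> 'n symbol"
  where "deriv_coeffs i P = Poly_Mapping.map (pd i) P"

text \<open>The truncated subtraction below is harmless: the coefficient vanishes if \<open>\<alpha>\<^sub>j\<close>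
  (resp. \<open>\<beta>\<^sub>j\<close>) does not occur in the monomial.\<close>

definition deriv_alpha :: "'n::finite \<Rightarrow> 'n symbol \<Rightarrow> 'n symbol"
  where "deriv_alpha j P = (\<Sum>(a, b)\<in>Poly_Mapping.keys P.
    Poly_Mapping.single (a - Poly_Mapping.single j 1, b)
      (of_nat (Poly_Mapping.lookup a j) * Poly_Mapping.lookup P (a, b)))"

definition deriv_beta :: "'n::finite \<Rightarrow> 'n symbol \<Rightarrow> 'n symbol"
  where "deriv_beta j P = (\<Sum>(a, b)\<in>Poly_Mapping.keys P.
    Poly_Mapping.single (a, b - Poly_Mapping.single j 1)
      (of_nat (Poly_Mapping.lookup b j) * Poly_Mapping.lookup P (a, b)))"

definition lie_symbol :: "real \<Rightarrow> 'n::finite vector_field \<Rightarrow> 'n symbol \<Rightarrow> 'n symbol"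
  where "lie_symbol \<delta> X P =
    (\<Sum>i\<in>UNIV. coeff_symbol (X $ i) * deriv_coeffs i P)
    - (\<Sum>i\<in>UNIV. \<Sum>j\<in>UNIV. coeff_symbol (pd j (X $ i)) *
          (var_alpha i * deriv_alpha j P + var_beta i * deriv_beta j P))
    + scale_symbol \<delta> (coeff_symbol (divergence X) * P)"

definition multi_degree :: "'n::finite multi_index \<Rightarrow> nat"
  where "multi_degree a = (\<Sum>i\<in>UNIV. Poly_Mapping.lookup a i)"

definition monomial_degree :: "'n::finite multi_index \<times> 'n multi_index \<Rightarrow> nat"
  where "monomial_degree m = multi_degree (fst m) + multi_degree (snd m)"

text \<open>Only meaningful for \<open>P \<noteq> 0\<close>.\<close>

definition symbol_degree :: "'n::finite symbol \<Rightarrow> nat"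
  where "symbol_degree P = Max (monomial_degree ` Poly_Mapping.keys P)"

definition homogeneous_component :: "nat \<Rightarrow> 'n::finite symbol \<Rightarrow> 'n symbol"
  where "homogeneous_component k P =
    (\<Sum>m\<in>{m \<in> Poly_Mapping.keys P. monomial_degree m = k}.
       Poly_Mapping.single m (Poly_Mapping.lookup P m))"


section \<open>Bidifferential operators\<close>

type_synonym 'n bioperator = "'n smooth_fun \<Rightarrow> 'n smooth_fun \<Rightarrow> 'n smooth_fun"

text \<open>The order in which \<open>fold\<close> composes the partial derivatives is irrelevant by Schwarz's
  theorem, see \<open>multi_deriv_comp_fun_commute\<close> below.\<close>

definition multi_deriv :: "'n::finite multi_index \<Rightarrow> 'n smooth_fun \<Rightarrow> 'n smooth_fun"
  where "multi_deriv a f = Finite_Set.fold (\<lambda>i. pd i ^^ Poly_Mapping.lookup a i) f UNIV"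

definition bidiff_of_form :: "'n::finite symbol \<Rightarrow> 'n bioperator"
  where "bidiff_of_form P = (\<lambda>f g. \<Sum>(a, b)\<in>Poly_Mapping.keys P.
     Poly_Mapping.lookup P (a, b) * multi_deriv a f * multi_deriv b g)"

definition bidiff_operators :: "'n::finite bioperator set"
  where "bidiff_operators = range bidiff_of_form"

text \<open>The polynomial form is unique, see \<open>inj_bidiff_of_form\<close> below.\<close>

definition polynomial_form :: "'n::finite bioperator \<Rightarrow> 'n symbol"
  where "polynomial_form T = inv bidiff_of_form T"

definition total_order :: "'n::finite bioperator \<Rightarrow> nat"
  where "total_order T = symbol_degree (polynomial_form T)"

definition principal_symbol :: "'n::finite bioperator \<Rightarrow> 'n symbol"
  where "principal_symbol T = homogeneous_component (total_order T) (polynomial_form T)"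

definition lie_bidiff ::
    "real \<Rightarrow> real \<Rightarrow> real \<Rightarrow> 'n::finite vector_field \<Rightarrow> 'n bioperator \<Rightarrow> 'n bioperator"
  where "lie_bidiff lam\<^sub>1 lam\<^sub>2 \<mu> X T = (\<lambda>f g. lie_density \<mu> X (T f g)
           - T (lie_density lam\<^sub>1 X f) g - T f (lie_density lam\<^sub>2 X g))"

lemma funpow_pd_commute:
  "(pd i ^^ k) ((pd j ^^ l) f) = (pd j ^^ l) ((pd i ^^ k) f)"
proof -
  have 1: "pd i ((pd j ^^ l) f) = (pd j ^^ l) (pd i f)" for f
    by (induction l) (simp_all add: pd_commute[of i j])
  show ?thesis by (induction k) (simp_all add: 1)
qed

lemma multi_deriv_comp_fun_commute: "comp_fun_commute (\<lambda>i. pd i ^^ Poly_Mapping.lookup a i)"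
  by standard (simp add: fun_eq_iff funpow_pd_commute)

lemma apply_smooth_simps:
  "apply_smooth 0 x = 0" "apply_smooth 1 x = 1"
  "apply_smooth (f + g) x = apply_smooth f x + apply_smooth g x"
  "apply_smooth (f - g) x = apply_smooth f x - apply_smooth g x"
  "apply_smooth (f * g) x = apply_smooth f x * apply_smooth g x"
  "apply_smooth (c *\<^sub>R f) x = c * apply_smooth f x"
  "apply_smooth (coord i) x = x $ i"
  by (transfer; simp)+

lemma apply_smooth_sum: "apply_smooth (sum f A) x = (\<Sum>a\<in>A. apply_smooth (f a) x)"
  by (induction A rule: infinite_finite_induct) (auto simp: apply_smooth_simps)

lemma apply_smooth_prod: "apply_smooth (prod f A) x = (\<Prod>a\<in>A. apply_smooth (f a) x)"
  by (induction A rule: infinite_finite_induct) (auto simp: apply_smooth_simps)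

lemma apply_smooth_power: "apply_smooth (f ^ k) x = apply_smooth f x ^ k"
  by (induction k) (auto simp: apply_smooth_simps)

definition shifted_coord :: "real^'n::finite \<Rightarrow> 'n \<Rightarrow> 'n smooth_fun"
  where "shifted_coord p i = coord i - (p $ i) *\<^sub>R 1"

lemma pd_diff: "pd i (f - g) = pd i f - pd i g"
  by (metis pd_add diff_add_cancel add_diff_cancel)

lemma pd_shifted_coord: "pd i (shifted_coord p j) = (if i = j then 1 else 0)"
  by (simp add: shifted_coord_def pd_diff pd_scaleR pd_coord)

lemma pd_power: "pd i (f ^ k) = of_nat k * f ^ (k - 1) * pd i f"
proof (induction k)
  case (Suc k)
  then show ?case by (cases k) (simp_all add: pd_mult algebra_simps)
qed simp

lemma pd_of_nat_mult: "pd i (of_nat c * f) = of_nat c * pd i f"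
  by (induction c) (simp_all add: algebra_simps pd_add)

lemma funpow_pd_shifted_coord:
  "(pd i ^^ k) (shifted_coord p i ^ m) = of_nat (\<Prod>l<k. m - l) * shifted_coord p i ^ (m - k)"
  by (induction k)
     (simp_all add: pd_of_nat_mult pd_power pd_shifted_coord mult.assoc del: of_nat_prod)

lemma funpow_pd_mult: "pd i v = 0 \<Longrightarrow> (pd i ^^ k) (u * v) = (pd i ^^ k) u * v"
  by (induction k) (simp_all add: pd_mult)

lemma pd_prod_0: "(\<And>j. j \<in> A \<Longrightarrow> pd i (f j) = 0) \<Longrightarrow> pd i (prod f A) = 0"
  by (induction A rule: infinite_finite_induct) (auto simp: pd_mult)

lemma multi_deriv_monomial:
  "multi_deriv a' (\<Prod>i\<in>UNIV. shifted_coord p i ^ Poly_Mapping.lookup a i) =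
     (\<Prod>i\<in>UNIV. of_nat (\<Prod>l<Poly_Mapping.lookup a' i. Poly_Mapping.lookup a i - l) *
        shifted_coord p i ^ (Poly_Mapping.lookup a i - Poly_Mapping.lookup a' i))"
proof -
  let ?u = "\<lambda>i. shifted_coord p i ^ Poly_Mapping.lookup a i"
  let ?v = "\<lambda>i. of_nat (\<Prod>l<Poly_Mapping.lookup a' i. Poly_Mapping.lookup a i - l) *
        shifted_coord p i ^ (Poly_Mapping.lookup a i - Poly_Mapping.lookup a' i)"
  interpret comp_fun_commute "\<lambda>i. pd i ^^ Poly_Mapping.lookup a' i"
    by (rule multi_deriv_comp_fun_commute)
  have "Finite_Set.fold (\<lambda>i. pd i ^^ Poly_Mapping.lookup a' i) (prod ?u UNIV) F
          = prod ?v F * prod ?u (- F)" if "finite F" for F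
    using that
  proof (induction F)
    case empty
    then show ?case by simp
  next
    case (insert i F)
    have "- F = insert i (- insert i F)" using insert.hyps by auto
    then have "prod ?u (- F) = ?u i * prod ?u (- insert i F)"
      by (metis (no_types, lifting) ComplD finite insertI1 prod.insert)
    then have eq: "prod ?v F * prod ?u (- F) = ?u i * (prod ?v F * prod ?u (- insert i F))"
      by (simp only: ac_simps)
    have "pd i (prod ?v F) = 0"
    proof (rule pd_prod_0)
      fix j assume "j \<in> F"
      with insert.hyps have "i \<noteq> j" by auto
      then show "pd i (?v j) = 0"
        by (simp only: pd_of_nat_mult pd_power pd_shifted_coord if_False mult_zero_right)
    qed
    moreover have "pd i (prod ?u (- insert i F)) = 0"
      by (rule pd_prod_0) (auto simp: pd_power pd_shifted_coord)
    ultimately have 0: "pd i (prod ?v F * prod ?u (- insert i F)) = 0"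
      by (simp only: pd_mult mult_zero_right mult_zero_left add_0)
    have "Finite_Set.fold (\<lambda>i. pd i ^^ Poly_Mapping.lookup a' i) (prod ?u UNIV) (insert i F)
        = (pd i ^^ Poly_Mapping.lookup a' i) (prod ?v F * prod ?u (- F))"
      by (simp only: fold_insert[OF insert.hyps] insert.IH)
    also have "\<dots> = ?v i * (prod ?v F * prod ?u (- insert i F))"
      by (simp only: eq funpow_pd_mult[OF 0] funpow_pd_shifted_coord)
    also have "\<dots> = prod ?v (insert i F) * prod ?u (- insert i F)"
      by (simp only: prod.insert[OF insert.hyps] mult.assoc)
    finally show ?case .
  qed
  from this[of UNIV] show ?thesis by (simp add: multi_deriv_def)
qed

lemma multi_deriv_monomial_at:
  "apply_smooth (multi_deriv a' (\<Prod>i\<in>UNIV. shifted_coord p i ^ Poly_Mapping.lookup a i)) p \<noteq> 0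
     \<longleftrightarrow> a' = a"
proof -
  have N: "apply_smooth (of_nat c) p = of_nat c" for c
    by (induction c) (auto simp: apply_smooth_simps)
  have factor: "real (\<Prod>l<k. m - l) * 0 ^ (m - k) \<noteq> 0 \<longleftrightarrow> k = m" for k m :: nat
    by (cases k m rule: linorder_cases) auto
  have "apply_smooth (shifted_coord p i) p = 0" for i
    by (simp add: shifted_coord_def apply_smooth_simps)
  then have "apply_smooth (multi_deriv a' (\<Prod>i\<in>UNIV. shifted_coord p i ^ Poly_Mapping.lookup a i)) p =
      (\<Prod>i\<in>UNIV. real (\<Prod>l<Poly_Mapping.lookup a' i. Poly_Mapping.lookup a i - l) *
        0 ^ (Poly_Mapping.lookup a i - Poly_Mapping.lookup a' i))"
    by (simp only: multi_deriv_monomial apply_smooth_prod apply_smooth_power apply_smooth_simps N)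
  also have "\<dots> \<noteq> 0 \<longleftrightarrow> (\<forall>i. Poly_Mapping.lookup a' i = Poly_Mapping.lookup a i)"
    by (simp only: prod_zero_iff finite factor[symmetric]) blast
  finally show ?thesis by (simp only: poly_mapping_eq_iff fun_eq_iff)
qed

lemma bidiff_of_form_superset:
  assumes "finite K" "Poly_Mapping.keys P \<subseteq> K"
  shows "bidiff_of_form P f g =
    (\<Sum>m\<in>K. Poly_Mapping.lookup P m * multi_deriv (fst m) f * multi_deriv (snd m) g)"
  unfolding bidiff_of_form_def case_prod_beta
  using assms by (auto intro!: sum.mono_neutral_left simp: in_keys_iff)

lemma inj_bidiff_of_form: "inj bidiff_of_form"
proof (rule injI, rule poly_mapping_eqI)
  fix P Q :: "'n::finite symbol" and m
  assume eq: "bidiff_of_form P = bidiff_of_form Q"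
  show "Poly_Mapping.lookup P m = Poly_Mapping.lookup Q m"
  proof (subst apply_smooth_inject[symmetric], rule ext)
    fix p :: "real^'n"
    let ?f = "\<Prod>i\<in>UNIV. shifted_coord p i ^ Poly_Mapping.lookup (fst m) i"
    let ?g = "\<Prod>i\<in>UNIV. shifted_coord p i ^ Poly_Mapping.lookup (snd m) i"
    let ?c = "apply_smooth (multi_deriv (fst m) ?f) p * apply_smooth (multi_deriv (snd m) ?g) p"
    let ?K = "insert m (Poly_Mapping.keys P \<union> Poly_Mapping.keys Q)"
    have val: "apply_smooth (bidiff_of_form R ?f ?g) p = apply_smooth (Poly_Mapping.lookup R m) p * ?c"
      if "Poly_Mapping.keys R \<subseteq> ?K" for R
    proof -
      have "apply_smooth (bidiff_of_form R ?f ?g) p = (\<Sum>m'\<in>?K. apply_smooth (Poly_Mapping.lookup R m') p *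
          apply_smooth (multi_deriv (fst m') ?f) p * apply_smooth (multi_deriv (snd m') ?g) p)"
        using that by (subst bidiff_of_form_superset[of ?K]) (auto simp: apply_smooth_sum apply_smooth_simps)
      also have "\<dots> = (\<Sum>m'\<in>?K. if m' = m then apply_smooth (Poly_Mapping.lookup R m) p * ?c else 0)"
        using multi_deriv_monomial_at[of _ p "fst m"] multi_deriv_monomial_at[of _ p "snd m"]
        by (intro sum.cong refl) (auto simp: prod_eq_iff)
      finally show ?thesis by simp
    qed
    have "?c \<noteq> 0"
      using multi_deriv_monomial_at[of "fst m" p] multi_deriv_monomial_at[of "snd m" p] by auto
    moreover have "apply_smooth (Poly_Mapping.lookup P m) p * ?c = apply_smooth (Poly_Mapping.lookup Q m) p * ?c"
      unfolding val[of P, symmetric, OF subset_insertI2[OF Un_upper1]]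
        val[of Q, symmetric, OF subset_insertI2[OF Un_upper2]] eq ..
    ultimately show "apply_smooth (Poly_Mapping.lookup P m) p = apply_smooth (Poly_Mapping.lookup Q m) p"
      by simp
  qed
qed

lemma polynomial_form_bidiff_of_form: "polynomial_form (bidiff_of_form P) = P"
  by (simp add: polynomial_form_def inj_bidiff_of_form)

section \<open>Equivariant symbol maps\<close>

text \<open>A map on bioperators is only constrained on the bidifferential ones.  The zero operator,
  which has no order, is mapped to \<open>0\<close> by linearity.\<close>

definition equivariant_symbol_map ::
    "real \<Rightarrow> real \<Rightarrow> real \<Rightarrow> ('n::finite bioperator \<Rightarrow> 'n symbol) \<Rightarrow> bool"
  where "equivariant_symbol_map lam\<^sub>1 lam\<^sub>2 \<mu> \<sigma> \<longleftrightarrow>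
    (\<forall>S\<in>bidiff_operators. \<forall>T\<in>bidiff_operators. \<sigma> (\<lambda>f g. S f g + T f g) = \<sigma> S + \<sigma> T) \<and>
    (\<forall>c. \<forall>T\<in>bidiff_operators. \<sigma> (\<lambda>f g. c *\<^sub>R T f g) = scale_symbol c (\<sigma> T)) \<and>
    bij_betw \<sigma> bidiff_operators UNIV \<and>
    (\<forall>T\<in>bidiff_operators. T \<noteq> (\<lambda>f g. 0) \<longrightarrow>
        \<sigma> T \<noteq> 0 \<and> symbol_degree (\<sigma> T) = total_order T \<and>
        homogeneous_component (total_order T) (\<sigma> T) = principal_symbol T) \<and>
    (\<forall>X\<in>sl_fields. \<forall>T\<in>bidiff_operators.
        \<sigma> (lie_bidiff lam\<^sub>1 lam\<^sub>2 \<mu> X T) = lie_symbol (\<mu> - lam\<^sub>1 - lam\<^sub>2) X (\<sigma> T))"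

end

theory Submission
  imports Defs
begin

text \<open>Fix a coordinate \<open>x\<^sup>k\<close>, let \<open>E = \<Sum>\<^sub>i x\<^sup>i \<partial>\<^sub>i\<close> be the Euler field, and let \<open>m\<close> be one of
  the monomials \<open>\<alpha>\<^sub>k\<^sup>2\<close> and \<open>\<alpha>\<^sub>k \<beta>\<^sub>k\<close>.  For a function \<open>c\<close> write \<open>T\<^sub>c\<close> for the bidifferential
  operator with polynomial form \<open>c m\<close>.  Let \<open>\<sigma>\<close> be an equivariant symbol map.

  Equivariance under the translations and under the one field \<open>x\<^sup>k \<partial>\<^sub>k\<close> already forces
  \<open>\<sigma> T\<^sub>c = c m\<close> for \<open>c = 1\<close> and for \<open>c = x\<^sup>i\<close> with \<open>i \<noteq> k\<close>.  Indeed \<open>\<sigma> T\<^sub>c - c m\<close> has degree less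
  than 2, has constant coefficients (by translations, after the case \<open>c = 1\<close> is settled) and has
  the same weight \<open>\<delta> - 2\<close> under \<open>x\<^sup>k \<partial>\<^sub>k\<close> as \<open>c m\<close>; but the weight of a monomial with constant
  coefficient is \<open>\<delta>\<close> minus its degree in \<open>\<alpha>\<^sub>k, \<beta>\<^sub>k\<close>, so no monomial of degree less than 2 can occur
  (\<open>symbol_map_axis_operator_step\<close>).

  The resonance enters through one computation with the quadratic field \<open>x\<^sup>k E\<close>: since
  \<open>(n + 1) \<delta> = n + 3\<close>,
  \<open>L\<^bsub>x\<^sup>k E\<^esub> m = \<Sum>\<^bsub>i \<noteq> k\<^esub> L\<^bsub>x\<^sup>k \<partial>\<^sub>i\<^esub> (x\<^sup>i m)\<close>
  in the module of symbols (\<open>lie_symbol_quadratic_field_axis_monomial\<close>).  All the symbols in this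
  identity are values of \<open>\<sigma>\<close> at known operators, so equivariance and injectivity of \<open>\<sigma>\<close> give the
  same identity between operators (\<open>resonant_lie_bidiff_identity\<close>):
  \<open>L\<^bsub>x\<^sup>k E\<^esub> T\<^sub>1 = \<Sum>\<^bsub>i \<noteq> k\<^esub> L\<^bsub>x\<^sup>k \<partial>\<^sub>i\<^esub> T\<^bsub>x\<^sup>i\<^esub>\<close>.
  The two sides differ by a first order operator that depends on the weights.  For \<open>m = \<alpha>\<^sub>k\<^sup>2\<close>,
  evaluating at \<open>(x\<^sup>k, 1)\<close> gives \<open>1 + (n + 1) \<lambda>\<^sub>1 = 0\<close>; for \<open>m = \<alpha>\<^sub>k \<beta>\<^sub>k\<close>, evaluating at
  \<open>(1, x\<^sup>k)\<close> gives \<open>(n + 1) \<lambda>\<^sub>1 = 0\<close>.  These exclude each other.\<close>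


section \<open>Arithmetic of symbols\<close>

lemma of_nat_mult_scaleR: "of_nat r * h = real r *\<^sub>R (h :: 'a::real_algebra_1)"
  by (simp add: scaleR_conv_of_real)

lemma lookup_scale_symbol:
  "Poly_Mapping.lookup (scale_symbol c P) m = c *\<^sub>R Poly_Mapping.lookup P m"
  by (simp add: scale_symbol_def Poly_Mapping.map.rep_eq when_def)

lemma scale_symbol_0 [simp]: "scale_symbol c 0 = 0"
  by (rule poly_mapping_eqI) (simp add: lookup_scale_symbol)

lemma lookup_deriv_coeffs:
  "Poly_Mapping.lookup (deriv_coeffs i P) m = pd i (Poly_Mapping.lookup P m)"
  by (simp add: deriv_coeffs_def Poly_Mapping.map.rep_eq when_def)

lemma lookup_coeff_symbol_mult:
  "Poly_Mapping.lookup (coeff_symbol c * P) m = c * Poly_Mapping.lookup P m"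
  by (simp add: coeff_symbol_def mult_map_scale_conv_mult[symmetric] Poly_Mapping.map.rep_eq when_def)

lemma coeff_symbol_0 [simp]: "coeff_symbol 0 = 0"
  by (simp add: coeff_symbol_def)

lemma coeff_symbol_1 [simp]: "coeff_symbol 1 = 1"
  by (simp add: coeff_symbol_def)

lemma coeff_symbol_add: "coeff_symbol (c + d) = coeff_symbol c + coeff_symbol d"
  by (simp add: coeff_symbol_def single_add)

lemma deriv_coeffs_single:
  "deriv_coeffs i (Poly_Mapping.single m c) = Poly_Mapping.single m (pd i c)"
  by (rule poly_mapping_eqI) (simp add: lookup_deriv_coeffs lookup_single when_def)

lemma deriv_alpha_single:
  "deriv_alpha j (Poly_Mapping.single (a, b) c) =
     Poly_Mapping.single (a - Poly_Mapping.single j 1, b) (of_nat (Poly_Mapping.lookup a j) * c)"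
  by (simp add: deriv_alpha_def)

lemma deriv_beta_single:
  "deriv_beta j (Poly_Mapping.single (a, b) c) =
     Poly_Mapping.single (a, b - Poly_Mapping.single j 1) (of_nat (Poly_Mapping.lookup b j) * c)"
  by (simp add: deriv_beta_def)

lemma single_plus_minus_single:
  assumes "Poly_Mapping.lookup a j \<noteq> (0::nat)"
  shows "Poly_Mapping.single j 1 + (a - Poly_Mapping.single j 1) = a"
  by (rule poly_mapping_eqI) (use assms in \<open>auto simp: lookup_add lookup_minus lookup_single when_def\<close>)

text \<open>Euler's identity for one variable: \<open>\<alpha>\<^sub>j D\<^bsub>\<alpha>\<^sub>j\<^esub>\<close> is diagonal on monomials.  The truncated
  exponent \<open>a\<^sub>j - 1\<close> in the derivative only matters for \<open>a\<^sub>j = 0\<close>, where the coefficient is zero.\<close>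

lemma lookup_alpha_deriv_alpha:
  "Poly_Mapping.lookup (var_alpha j * deriv_alpha j P) m =
     of_nat (Poly_Mapping.lookup (fst m) j) * Poly_Mapping.lookup P m"
proof -
  have "var_alpha j * deriv_alpha j P = (\<Sum>m\<in>Poly_Mapping.keys P.
      Poly_Mapping.single m (of_nat (Poly_Mapping.lookup (fst m) j) * Poly_Mapping.lookup P m))"
    unfolding var_alpha_def deriv_alpha_def sum_distrib_left
  proof (intro sum.cong refl, clarify)
    fix a b
    show "Poly_Mapping.single (Poly_Mapping.single j 1, 0) 1 *
        Poly_Mapping.single (a - Poly_Mapping.single j 1, b)
          (of_nat (Poly_Mapping.lookup a j) * Poly_Mapping.lookup P (a, b)) =
      Poly_Mapping.single (a, b) (of_nat (Poly_Mapping.lookup (fst (a, b)) j) * Poly_Mapping.lookup P (a, b))"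
      by (cases "Poly_Mapping.lookup a j = 0")
         (simp_all add: mult_single single_plus_minus_single del: One_nat_def)
  qed
  then show ?thesis
    by (auto simp: lookup_sum lookup_single when_def in_keys_iff)
qed

lemma lookup_beta_deriv_beta:
  "Poly_Mapping.lookup (var_beta j * deriv_beta j P) m =
     of_nat (Poly_Mapping.lookup (snd m) j) * Poly_Mapping.lookup P m"
proof -
  have "var_beta j * deriv_beta j P = (\<Sum>m\<in>Poly_Mapping.keys P.
      Poly_Mapping.single m (of_nat (Poly_Mapping.lookup (snd m) j) * Poly_Mapping.lookup P m))"
    unfolding var_beta_def deriv_beta_def sum_distrib_left
  proof (intro sum.cong refl, clarify)
    fix a b
    show "Poly_Mapping.single (0, Poly_Mapping.single j 1) 1 *
        Poly_Mapping.single (a, b - Poly_Mapping.single j 1)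
          (of_nat (Poly_Mapping.lookup b j) * Poly_Mapping.lookup P (a, b)) =
      Poly_Mapping.single (a, b) (of_nat (Poly_Mapping.lookup (snd (a, b)) j) * Poly_Mapping.lookup P (a, b))"
      by (cases "Poly_Mapping.lookup b j = 0")
         (simp_all add: mult_single single_plus_minus_single del: One_nat_def)
  qed
  then show ?thesis
    by (auto simp: lookup_sum lookup_single when_def in_keys_iff)
qed

lemma lookup_homogeneous_component:
  "Poly_Mapping.lookup (homogeneous_component r P) m =
     (if monomial_degree m = r then Poly_Mapping.lookup P m else 0)"
  by (auto simp: homogeneous_component_def lookup_sum lookup_single when_def in_keys_iff)

lemma monomial_degree_le_symbol_degree:
  "Poly_Mapping.lookup P m \<noteq> 0 \<Longrightarrow> monomial_degree m \<le> symbol_degree P"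
  by (simp add: symbol_degree_def in_keys_iff)

lemma symbol_degree_single: "c \<noteq> 0 \<Longrightarrow> symbol_degree (Poly_Mapping.single m c) = monomial_degree m"
  by (simp add: symbol_degree_def)


section \<open>The projective vector fields and their action on symbols\<close>

definition linear_field :: "'n \<Rightarrow> 'n \<Rightarrow> 'n::finite vector_field"
  where "linear_field j i = axis i (coord j)"

definition quadratic_field :: "'n \<Rightarrow> 'n::finite vector_field"
  where "quadratic_field k = (\<chi> i. coord k * coord i)"

lemma translation_in_sl: "axis i 1 \<in> sl_fields"
  and linear_field_in_sl: "linear_field j i \<in> sl_fields"
  and quadratic_field_in_sl: "quadratic_field k \<in> sl_fields"
  unfolding sl_fields_def linear_field_def quadratic_field_def by (auto intro!: span_base)

lemma sum_axis_mult: "(\<Sum>i\<in>UNIV. (axis j c :: 'a::semiring_0 ^ 'n::finite) $ i * h i) = c * h j"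
  by (simp add: axis_def if_distrib[of "\<lambda>u. u * _"] cong: if_cong)

lemma pd_axis: "pd j (axis i c $ l) = (if l = i then pd j c else 0)"
  by (simp add: axis_def)

lemma divergence_translation: "divergence (axis i 1) = 0"
  by (simp add: divergence_def pd_axis)

lemma divergence_linear_field: "divergence (linear_field j i) = (if i = j then 1 else 0)"
  by (simp add: divergence_def linear_field_def pd_axis pd_coord)

lemma divergence_quadratic_field:
  "divergence (quadratic_field k :: 'n::finite vector_field) = (real CARD('n) + 1) *\<^sub>R coord k"
  by (simp add: divergence_def quadratic_field_def pd_mult pd_coord sum.distrib
      if_distrib[of "\<lambda>u. u * _"] scaleR_add_left of_nat_mult_scaleR cong: if_cong)

lemma lie_density_0 [simp]: "lie_density w X 0 = 0"
  by (simp add: lie_density_def)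

lemma lie_density_translation: "lie_density w (axis i 1) f = pd i f"
  by (simp add: lie_density_def divergence_translation sum_axis_mult)

lemma lie_density_linear_field:
  "lie_density w (linear_field j i) f = coord j * pd i f + (if i = j then w *\<^sub>R f else 0)"
  unfolding lie_density_def divergence_linear_field
  by (simp add: linear_field_def sum_axis_mult)

lemma lie_density_quadratic_field:
  "lie_density w (quadratic_field k) (f :: 'n::finite smooth_fun) =
     coord k * (\<Sum>i\<in>UNIV. coord i * pd i f) + (w * (real CARD('n) + 1)) *\<^sub>R (coord k * f)"
  unfolding lie_density_def divergence_quadratic_field
  by (simp add: quadratic_field_def sum_distrib_left mult.assoc)

text \<open>The action of the matrix unit \<open>(i, j)\<close> of the general linear Lie algebra on polynomials in
  \<open>\<alpha>, \<beta>\<close>; it carries the derivative of the vector field in the Lie derivative of a symbol.\<close>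

definition gl_action :: "'n \<Rightarrow> 'n::finite \<Rightarrow> 'n symbol \<Rightarrow> 'n symbol"
  where "gl_action i j P = var_alpha i * deriv_alpha j P + var_beta i * deriv_beta j P"

text \<open>Monomials are weight vectors for the diagonal fields \<open>x\<^sup>j \<partial>\<^sub>j\<close>.\<close>

lemma lookup_gl_action_diagonal:
  "Poly_Mapping.lookup (gl_action j j P) m =
     of_nat (Poly_Mapping.lookup (fst m) j + Poly_Mapping.lookup (snd m) j) * Poly_Mapping.lookup P m"
  by (simp add: gl_action_def lookup_add lookup_alpha_deriv_alpha lookup_beta_deriv_beta algebra_simps)

lemma lie_symbol_translation: "lie_symbol \<delta> (axis i 1) P = deriv_coeffs i P"
proof -
  have "coeff_symbol (axis i 1 $ l) = axis i 1 $ l" for l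
    by (simp add: axis_def)
  note axis = this
  show ?thesis
    unfolding lie_symbol_def divergence_translation pd_axis axis sum_axis_mult
    by (simp add: if_distrib[of coeff_symbol] cong: if_cong)
qed

lemma lie_symbol_linear_field:
  "lie_symbol \<delta> (linear_field j i) P = coeff_symbol (coord j) * deriv_coeffs i P - gl_action i j P
     + (if i = j then scale_symbol \<delta> P else 0)"
proof -
  have 1: "coeff_symbol (axis i (coord j) $ l) = axis i (coeff_symbol (coord j)) $ l" for l
    by (simp add: axis_def)
  have 2: "coeff_symbol (pd j' (axis i (coord j) $ l)) * u = (if j' = j \<and> l = i then u else 0)" for j' l u
    by (auto simp: axis_def pd_coord)
  have 3: "(\<Sum>l\<in>UNIV. \<Sum>j'\<in>UNIV. if j' = j \<and> l = i then h l j' else 0) = h i j"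
    for h :: "'a \<Rightarrow> 'a \<Rightarrow> 'a symbol"
  proof -
    have "(\<Sum>j'\<in>UNIV. if j' = j \<and> l = i then h l j' else 0) = (if l = i then h l j else 0)" for l
      by (cases "l = i") simp_all
    then show ?thesis by simp
  qed
  show ?thesis
    unfolding lie_symbol_def divergence_linear_field
    unfolding linear_field_def gl_action_def 1 2 3 sum_axis_mult by simp
qed


section \<open>Pure operators along one axis\<close>

definition axis_monomial :: "'n \<Rightarrow> nat \<Rightarrow> nat \<Rightarrow> 'n multi_index \<times> 'n::finite multi_index"
  where "axis_monomial k p q = (Poly_Mapping.single k p, Poly_Mapping.single k q)"

definition axis_operator :: "'n \<Rightarrow> nat \<Rightarrow> nat \<Rightarrow> 'n::finite smooth_fun \<Rightarrow> 'n bioperator"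
  where "axis_operator k p q c = (\<lambda>f g. c * (pd k ^^ p) f * (pd k ^^ q) g)"

lemma monomial_degree_axis_monomial: "monomial_degree (axis_monomial k p q) = p + q"
  by (simp add: monomial_degree_def multi_degree_def axis_monomial_def lookup_single when_def)

text \<open>The monomial only involves the variables with index \<open>k\<close>, so the other derivatives kill it.\<close>

lemma gl_action_axis_monomial:
  "gl_action i j (Poly_Mapping.single (axis_monomial k p q) c) =
     (if j = k then coeff_symbol c * gl_action i k (Poly_Mapping.single (axis_monomial k p q) 1) else 0)"
  by (simp add: gl_action_def axis_monomial_def deriv_alpha_single deriv_beta_single
      var_alpha_def var_beta_def coeff_symbol_def mult_single lookup_single when_def algebra_simps)

lemma gl_action_axis_monomial_diagonal:
  "gl_action k k (Poly_Mapping.single (axis_monomial k p q) c) =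
     Poly_Mapping.single (axis_monomial k p q) (of_nat (p + q) * c)"
  by (rule poly_mapping_eqI)
     (auto simp: lookup_gl_action_diagonal lookup_single when_def axis_monomial_def)

text \<open>With \<open>V\<^sub>i\<close> the image of \<open>m\<close> under \<open>\<alpha>\<^sub>i D\<^bsub>\<alpha>\<^sub>k\<^esub> + \<beta>\<^sub>i D\<^bsub>\<beta>\<^sub>k\<^esub>\<close>, so that \<open>V\<^sub>k = 2 m\<close>, the
  left-hand side is
  \<open>- \<Sum>\<^bsub>i \<noteq> k\<^esub> x\<^sup>i V\<^sub>i - 4 x\<^sup>k m + (n + 1) \<delta> x\<^sup>k m\<close>, and the term with index \<open>i\<close> on the
  right-hand side is \<open>x\<^sup>k m - x\<^sup>i V\<^sub>i\<close>.  There are \<open>n - 1\<close> such terms, so the two sides agree exactly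
  when \<open>(n + 1) \<delta> = n + 3\<close>.\<close>

lemma lie_symbol_quadratic_field_axis_monomial:
  fixes k :: "'n::finite"
  assumes "p + q = 2" and \<delta>: "\<delta> * (real CARD('n) + 1) = real CARD('n) + 3"
  shows "lie_symbol \<delta> (quadratic_field k) (Poly_Mapping.single (axis_monomial k p q) 1) =
    (\<Sum>i\<in>-{k}. lie_symbol \<delta> (linear_field k i) (Poly_Mapping.single (axis_monomial k p q) (coord i)))"
proof -
  let ?m = "axis_monomial k p q"
  let ?P = "Poly_Mapping.single ?m 1 :: 'n symbol"
  let ?x = "\<lambda>i. coeff_symbol (coord i) :: 'n symbol"
  let ?V = "\<lambda>i. gl_action i k ?P"
  have cancel: "(r + 3) *\<^sub>R u - (s + (u + u + u + u)) = (r - 1) *\<^sub>R u - s"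
    for r and u s :: "'n smooth_fun"
    by (simp add: scaleR_conv_of_real algebra_simps)
  \<comment> \<open>\<open>V\<^sub>k\<close> occurs with coefficient \<open>\<partial>\<^sub>k (x\<^sup>k x\<^sup>k) = 2 x\<^sup>k\<close>; with \<open>V\<^sub>k = 2 m\<close> this is the term \<open>4 x\<^sup>k m\<close>.\<close>
  have Vk: "?V k = ?P + ?P"
    using assms(1) by (simp add: gl_action_axis_monomial_diagonal single_add[symmetric])
  have "(\<Sum>j\<in>UNIV. coeff_symbol (pd j (quadratic_field k $ i)) * gl_action i j ?P) =
      ?x i * ?V i + (if i = k then ?x k * ?V k else 0)" for i
    by (subst gl_action_axis_monomial)
       (simp add: if_distrib[of "\<lambda>u. _ * u"] quadratic_field_def pd_mult pd_coord
          coeff_symbol_add algebra_simps cong: if_cong)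
  then have gl: "(\<Sum>i\<in>UNIV. \<Sum>j\<in>UNIV. coeff_symbol (pd j (quadratic_field k $ i)) * gl_action i j ?P) =
      (\<Sum>i\<in>-{k}. ?x i * ?V i) + (?x k * ?P + ?x k * ?P + ?x k * ?P + ?x k * ?P)"
    by (simp add: sum.distrib sum.remove[of UNIV k] Compl_eq_Diff_UNIV Vk algebra_simps)
  have div: "scale_symbol \<delta> (coeff_symbol (divergence (quadratic_field k)) * ?P) =
      scale_symbol (real CARD('n) + 3) (?x k * ?P)"
    by (rule poly_mapping_eqI)
       (simp add: lookup_scale_symbol lookup_coeff_symbol_mult divergence_quadratic_field \<delta>)
  have lhs: "lie_symbol \<delta> (quadratic_field k) ?P = scale_symbol (real CARD('n) + 3) (?x k * ?P)
      - ((\<Sum>i\<in>-{k}. ?x i * ?V i) + (?x k * ?P + ?x k * ?P + ?x k * ?P + ?x k * ?P))"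
    unfolding lie_symbol_def gl_action_def[symmetric] gl div by (simp add: deriv_coeffs_single)
  have "lie_symbol \<delta> (linear_field k i) (Poly_Mapping.single ?m (coord i)) =
      ?x k * ?P - ?x i * ?V i" if "i \<noteq> k" for i
    using that
    by (simp add: lie_symbol_linear_field deriv_coeffs_single pd_coord)
       (subst gl_action_axis_monomial, simp)
  then have "(\<Sum>i\<in>-{k}. lie_symbol \<delta> (linear_field k i) (Poly_Mapping.single ?m (coord i))) =
      (\<Sum>i\<in>-{k}. ?x k * ?P - ?x i * ?V i)"
    by (intro sum.cong) auto
  also have "\<dots> = scale_symbol (real CARD('n) - 1) (?x k * ?P) - (\<Sum>i\<in>-{k}. ?x i * ?V i)"
  proof -
    have "(\<Sum>i\<in>-{k}. ?x k * ?P) = scale_symbol (real CARD('n) - 1) (?x k * ?P)"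
      by (rule poly_mapping_eqI)
         (simp add: lookup_sum lookup_scale_symbol sum_constant_scaleR Compl_eq_Diff_UNIV card_Diff_singleton of_nat_diff Suc_leI
            del: sum_constant)
    then show ?thesis by (simp only: sum_subtractf)
  qed
  also have "\<dots> = lie_symbol \<delta> (quadratic_field k) ?P"
    unfolding lhs
    by (rule sym, rule poly_mapping_eqI)
       (simp only: lookup_minus lookup_add lookup_scale_symbol cancel)
  finally show ?thesis by simp
qed

lemma multi_deriv_0: "multi_deriv 0 f = f"
proof -
  have "Finite_Set.fold (\<lambda>i. pd i ^^ Poly_Mapping.lookup (0 :: 'a multi_index) i) f F = f" if "finite F" for F
    using that
  proof (induction F)
    case (insert i F)
    interpret comp_fun_commute "\<lambda>i. pd i ^^ Poly_Mapping.lookup (0 :: 'a multi_index) i"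
      by (rule multi_deriv_comp_fun_commute)
    show ?case unfolding fold_insert[OF insert.hyps] insert.IH by simp
  qed simp
  from this[of UNIV] show ?thesis by (simp add: multi_deriv_def)
qed

text \<open>Folding over a subset of the indices applies the extra derivative as soon as the index \<open>i\<close>
  has been met; by Schwarz's theorem it can be moved to the front.\<close>

lemma multi_deriv_single_plus:
  fixes a :: "'n::finite multi_index"
  shows "multi_deriv (Poly_Mapping.single i 1 + a) f = pd i (multi_deriv a f)"
proof -
  let ?b = "Poly_Mapping.single i 1 + a"
  interpret a: comp_fun_commute "\<lambda>i. pd i ^^ Poly_Mapping.lookup a i"
    by (rule multi_deriv_comp_fun_commute)
  interpret b: comp_fun_commute "\<lambda>i. pd i ^^ Poly_Mapping.lookup ?b i"
    by (rule multi_deriv_comp_fun_commute)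
  have "Finite_Set.fold (\<lambda>i. pd i ^^ Poly_Mapping.lookup ?b i) f F =
      (if i \<in> F then pd i else id) (Finite_Set.fold (\<lambda>i. pd i ^^ Poly_Mapping.lookup a i) f F)"
    if "finite F" for F
    using that
  proof (induction F)
    case (insert j F)
    have comm: "(pd j ^^ r) (pd i h) = pd i ((pd j ^^ r) h)" for r h
      using funpow_pd_commute[where i = j and k = r and j = i and l = 1 and f = h] by simp
    show ?case
      unfolding a.fold_insert[OF insert.hyps] b.fold_insert[OF insert.hyps] insert.IH
      using insert.hyps by (auto simp: lookup_add lookup_single when_def comm)
  qed simp
  from this[of UNIV] show ?thesis by (simp add: multi_deriv_def)
qed

lemma multi_deriv_single: "multi_deriv (Poly_Mapping.single k p) f = (pd k ^^ p) f"
proof (induction p)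
  case (Suc p)
  have "Poly_Mapping.single k (Suc p) = Poly_Mapping.single k 1 + Poly_Mapping.single k p"
    by (simp add: single_add[symmetric])
  then show ?case by (simp only: multi_deriv_single_plus Suc.IH) simp
qed (simp add: multi_deriv_0)

lemma bidiff_of_form_single:
  "bidiff_of_form (Poly_Mapping.single (a, b) c) = (\<lambda>f g. c * multi_deriv a f * multi_deriv b g)"
  by (simp add: bidiff_of_form_def fun_eq_iff)

lemma axis_operator_eq:
  "axis_operator k p q c = bidiff_of_form (Poly_Mapping.single (axis_monomial k p q) c)"
  by (simp add: axis_operator_def axis_monomial_def bidiff_of_form_single multi_deriv_single)

lemma axis_operator_in: "axis_operator k p q c \<in> bidiff_operators"
  by (simp add: axis_operator_eq bidiff_operators_def)

lemma funpow_pd_add: "(pd k ^^ p) (f + g) = (pd k ^^ p) f + (pd k ^^ p) g"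
  by (induction p) (simp_all add: pd_add)

lemma funpow_pd_scaleR: "(pd k ^^ p) (c *\<^sub>R f) = c *\<^sub>R (pd k ^^ p) f"
  by (induction p) (simp_all add: pd_scaleR)

lemma funpow_pd_0 [simp]: "(pd k ^^ p) 0 = 0"
  by (induction p) simp_all

lemma pd_of_nat [simp]: "pd i (of_nat r) = 0"
  using pd_of_nat_mult[of i r 1] by simp

lemma pd_numeral [simp]: "pd i (numeral r) = 0"
  using pd_of_nat[of i "numeral r"] by simp

lemma funpow_pd_coord_mult:
  "(pd k ^^ p) (coord k * pd k f) = coord k * pd k ((pd k ^^ p) f) + of_nat p * (pd k ^^ p) f"
  by (induction p) (simp_all add: pd_add pd_mult pd_coord pd_of_nat_mult algebra_simps)

lemma lie_bidiff_translation_axis_operator: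
  "lie_bidiff lam\<^sub>1 lam\<^sub>2 \<mu> (axis j 1) (axis_operator k p q c) = axis_operator k p q (pd j c)"
proof -
  have comm: "(pd k ^^ r) (pd j h) = pd j ((pd k ^^ r) h)" for r h
    using funpow_pd_commute[where i = k and k = r and j = j and l = 1 and f = h] by simp
  show ?thesis
    by (simp add: lie_bidiff_def axis_operator_def lie_density_translation comm pd_mult algebra_simps fun_eq_iff)
qed

text \<open>The operator counterpart of the weight of a monomial: each of the \<open>p + q\<close> derivatives
  in direction \<open>k\<close> contributes \<open>-1\<close> by its commutator with \<open>x\<^sup>k \<partial>\<^sub>k\<close>.\<close>

lemma lie_bidiff_diagonal_axis_operator:
  assumes "pd k c = 0"
  shows "lie_bidiff lam\<^sub>1 lam\<^sub>2 \<mu> (linear_field k k) (axis_operator k p q c) =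
    (\<lambda>f g. (\<mu> - lam\<^sub>1 - lam\<^sub>2 - real (p + q)) *\<^sub>R axis_operator k p q c f g)"
proof -
  show ?thesis
    by (simp add: lie_bidiff_def axis_operator_def lie_density_linear_field funpow_pd_add funpow_pd_scaleR
        funpow_pd_coord_mult pd_mult assms fun_eq_iff of_nat_mult_scaleR scaleR_add_left scaleR_left_diff_distrib algebra_simps)
qed


section \<open>Closure of the bidifferential operators\<close>

lemma bidiff_of_form_add:
  "bidiff_of_form (P + Q) = (\<lambda>f g. bidiff_of_form P f g + bidiff_of_form Q f g)"
proof (intro ext)
  fix f g
  let ?K = "Poly_Mapping.keys P \<union> Poly_Mapping.keys Q"
  show "bidiff_of_form (P + Q) f g = bidiff_of_form P f g + bidiff_of_form Q f g"
    using Poly_Mapping.keys_add[of P Q]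
    by (subst (1 2 3) bidiff_of_form_superset[of ?K])
       (auto simp: lookup_add sum.distrib[symmetric] algebra_simps)
qed

lemma bidiff_add:
  "S \<in> bidiff_operators \<Longrightarrow> T \<in> bidiff_operators \<Longrightarrow> (\<lambda>f g. S f g + T f g) \<in> bidiff_operators"
  unfolding bidiff_operators_def by (auto simp: bidiff_of_form_add[symmetric])

lemma bidiff_monomial: "(\<lambda>f g. c * multi_deriv a f * multi_deriv b g) \<in> bidiff_operators"
  by (simp add: bidiff_of_form_single[symmetric] bidiff_operators_def)

lemma bidiff_0: "(\<lambda>f g. 0) \<in> bidiff_operators"
  using bidiff_monomial[of 0] by simp

lemma bidiff_sum:
  "(\<And>i. i \<in> A \<Longrightarrow> T i \<in> bidiff_operators) \<Longrightarrow> (\<lambda>f g. \<Sum>i\<in>A. T i f g) \<in> bidiff_operators"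
  by (induction A rule: infinite_finite_induct) (auto intro: bidiff_0 bidiff_add)

lemma bidiff_mult: "T \<in> bidiff_operators \<Longrightarrow> (\<lambda>f g. c * T f g) \<in> bidiff_operators"
proof -
  assume "T \<in> bidiff_operators"
  then obtain P where "T = bidiff_of_form P" by (auto simp: bidiff_operators_def)
  then have "(\<lambda>f g. c * T f g) = (\<lambda>f g. \<Sum>m\<in>Poly_Mapping.keys P.
      (c * Poly_Mapping.lookup P m) * multi_deriv (fst m) f * multi_deriv (snd m) g)"
    by (simp add: bidiff_of_form_def case_prod_beta sum_distrib_left mult.assoc)
  then show ?thesis by (simp only: bidiff_sum bidiff_monomial)
qed

lemma bidiff_diff:
  "S \<in> bidiff_operators \<Longrightarrow> T \<in> bidiff_operators \<Longrightarrow> (\<lambda>f g. S f g - T f g) \<in> bidiff_operators"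
  using bidiff_add[of S "\<lambda>f g. (-1) * T f g"] bidiff_mult[of T "-1"] by simp

lemma pd_sum: "pd i (sum h A) = (\<Sum>a\<in>A. pd i (h a))"
  by (induction A rule: infinite_finite_induct) (auto simp: pd_add)

lemma bidiff_pd: "T \<in> bidiff_operators \<Longrightarrow> (\<lambda>f g. pd i (T f g)) \<in> bidiff_operators"
proof -
  assume "T \<in> bidiff_operators"
  then obtain P where "T = bidiff_of_form P" by (auto simp: bidiff_operators_def)
  then have "(\<lambda>f g. pd i (T f g)) = (\<lambda>f g. \<Sum>m\<in>Poly_Mapping.keys P.
      Poly_Mapping.lookup P m * multi_deriv (fst m) f * multi_deriv (Poly_Mapping.single i 1 + snd m) g +
      (Poly_Mapping.lookup P m * multi_deriv (Poly_Mapping.single i 1 + fst m) f * multi_deriv (snd m) g +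
       pd i (Poly_Mapping.lookup P m) * multi_deriv (fst m) f * multi_deriv (snd m) g))"
    unfolding multi_deriv_single_plus
    by (simp add: bidiff_of_form_def case_prod_beta pd_sum pd_mult algebra_simps)
  then show ?thesis by (simp only: bidiff_sum bidiff_add bidiff_monomial)
qed

text \<open>Equivariance and injectivity of a symbol map are only available on bidifferential operators,
  so the Lie derivatives have to be recognised as such.  Describing the linear differential operators
  by the operations that generate them makes closure under composition immediate; normal forms are
  then only needed for products of two such operators.\<close>

inductive linear_diffop :: "('n::finite smooth_fun \<Rightarrow> 'n smooth_fun) \<Rightarrow> bool" where
  base: "linear_diffop (\<lambda>f. f)"
| mult: "linear_diffop L \<Longrightarrow> linear_diffop (\<lambda>f. c * L f)"
| deriv: "linear_diffop L \<Longrightarrow> linear_diffop (\<lambda>f. pd i (L f))"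
| add: "linear_diffop L \<Longrightarrow> linear_diffop M \<Longrightarrow> linear_diffop (\<lambda>f. L f + M f)"

lemma linear_diffop_0: "linear_diffop (\<lambda>f. 0)"
  using linear_diffop.mult[OF linear_diffop.base, of 0] by simp

lemma linear_diffop_comp: "linear_diffop L \<Longrightarrow> linear_diffop M \<Longrightarrow> linear_diffop (\<lambda>f. L (M f))"
  by (induction rule: linear_diffop.induct) (auto intro: linear_diffop.intros)

lemma linear_diffop_sum:
  "(\<And>i. i \<in> A \<Longrightarrow> linear_diffop (L i)) \<Longrightarrow> linear_diffop (\<lambda>f. \<Sum>i\<in>A. L i f)"
  by (induction A rule: infinite_finite_induct) (auto intro: linear_diffop_0 linear_diffop.add)

lemma linear_diffop_lie_density: "linear_diffop (lie_density w X)"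
proof -
  have "lie_density w X = (\<lambda>f. (\<Sum>i\<in>UNIV. X $ i * pd i f) + (w *\<^sub>R divergence X) * f)"
    by (simp add: lie_density_def fun_eq_iff)
  then show ?thesis
    by (simp only:) (intro linear_diffop.intros linear_diffop_sum)
qed

lemma linear_diffop_funpow_pd: "linear_diffop (pd k ^^ p)"
  by (induction p) (auto simp: comp_def id_def intro: linear_diffop.intros)

text \<open>The Leibniz rule read backwards moves a derivative off the second factor, either to the
  whole product or to the first factor; hence the arbitrary multi-index there.\<close>

lemma bidiff_product_of_multi_deriv:
  "linear_diffop M \<Longrightarrow> (\<lambda>f g. multi_deriv a f * M g) \<in> bidiff_operators"
proof (induction arbitrary: a rule: linear_diffop.induct)
  case base
  show ?case using bidiff_monomial[of 1 a 0] by (simp add: multi_deriv_0)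
next
  case (mult M c)
  then show ?case using bidiff_mult[OF mult.IH[of a], of c] by (simp add: ac_simps)
next
  case (deriv M i)
  have "(\<lambda>f g. multi_deriv a f * pd i (M g)) =
      (\<lambda>f g. pd i (multi_deriv a f * M g) - multi_deriv (Poly_Mapping.single i 1 + a) f * M g)"
    unfolding multi_deriv_single_plus by (simp add: pd_mult)
  then show ?case by (simp only: bidiff_diff bidiff_pd deriv.IH)
next
  case (add L M)
  then show ?case by (simp add: distrib_left bidiff_add)
qed

lemma bidiff_product:
  "linear_diffop L \<Longrightarrow> linear_diffop M \<Longrightarrow> (\<lambda>f g. L f * M g) \<in> bidiff_operators"
proof (induction arbitrary: M rule: linear_diffop.induct)
  case base
  then show ?case using bidiff_product_of_multi_deriv[of M 0] by (simp add: multi_deriv_0)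
next
  case (mult L c)
  then show ?case using bidiff_mult[OF mult.IH[of M], of c] by (simp add: ac_simps)
next
  case (deriv L i)
  have "(\<lambda>f g. pd i (L f) * M g) = (\<lambda>f g. pd i (L f * M g) - L f * pd i (M g))"
    by (simp add: pd_mult)
  then show ?case by (simp only: bidiff_diff bidiff_pd deriv linear_diffop.deriv)
next
  case (add L L')
  then show ?case by (simp add: distrib_right bidiff_add)
qed

text \<open>The three terms of the Lie derivative are a density derivative of a bidifferential operator
  and two products of linear differential operators.\<close>

lemma lie_bidiff_axis_operator_in:
  "lie_bidiff lam\<^sub>1 lam\<^sub>2 \<mu> X (axis_operator k p q c) \<in> bidiff_operators"
proof -
  let ?D = "\<lambda>r. pd k ^^ r"
  have density: "(\<lambda>f g. lie_density \<mu> X (T f g)) \<in> bidiff_operators" if "T \<in> bidiff_operators" for T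
  proof -
    have "(\<lambda>f g. lie_density \<mu> X (T f g)) =
        (\<lambda>f g. (\<Sum>i\<in>UNIV. X $ i * pd i (T f g)) + (\<mu> *\<^sub>R divergence X) * T f g)"
      by (simp add: lie_density_def fun_eq_iff)
    with that show ?thesis by (simp only: bidiff_add bidiff_sum bidiff_mult bidiff_pd)
  qed
  have prod: "(\<lambda>f g. c * L f * M g) \<in> bidiff_operators" if "linear_diffop L" "linear_diffop M" for L M
    using bidiff_product[OF linear_diffop.mult[OF that(1)] that(2)] .
  note lin = linear_diffop_funpow_pd linear_diffop_comp[OF linear_diffop_funpow_pd linear_diffop_lie_density]
  show ?thesis
    unfolding lie_bidiff_def axis_operator_def by (intro bidiff_diff density prod lin)
qed


section \<open>Values of an equivariant symbol map\<close>

context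
  fixes \<sigma> :: "'n::finite bioperator \<Rightarrow> 'n symbol" and lam\<^sub>1 lam\<^sub>2 \<mu> :: real
  assumes \<sigma>: "equivariant_symbol_map lam\<^sub>1 lam\<^sub>2 \<mu> \<sigma>"
begin

lemma symbol_map_scaleR:
  "T \<in> bidiff_operators \<Longrightarrow> \<sigma> (\<lambda>f g. c *\<^sub>R T f g) = scale_symbol c (\<sigma> T)"
  using \<sigma> by (simp add: equivariant_symbol_map_def)

lemma symbol_map_add:
  "S \<in> bidiff_operators \<Longrightarrow> T \<in> bidiff_operators \<Longrightarrow> \<sigma> (\<lambda>f g. S f g + T f g) = \<sigma> S + \<sigma> T"
  using \<sigma> by (simp add: equivariant_symbol_map_def)

lemma symbol_map_0: "\<sigma> (\<lambda>f g. 0) = 0"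
  using symbol_map_scaleR[OF bidiff_0, of 0] by (simp add: poly_mapping_eq_iff fun_eq_iff lookup_scale_symbol)

lemma symbol_map_sum:
  "(\<And>i. i \<in> A \<Longrightarrow> T i \<in> bidiff_operators) \<Longrightarrow> \<sigma> (\<lambda>f g. \<Sum>i\<in>A. T i f g) = (\<Sum>i\<in>A. \<sigma> (T i))"
  by (induction A rule: infinite_finite_induct) (simp_all add: symbol_map_0 symbol_map_add bidiff_sum)

lemma symbol_map_lie:
  "X \<in> sl_fields \<Longrightarrow> T \<in> bidiff_operators \<Longrightarrow>
     \<sigma> (lie_bidiff lam\<^sub>1 lam\<^sub>2 \<mu> X T) = lie_symbol (\<mu> - lam\<^sub>1 - lam\<^sub>2) X (\<sigma> T)"
  using \<sigma> by (simp add: equivariant_symbol_map_def)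

lemma symbol_map_injective:
  "S \<in> bidiff_operators \<Longrightarrow> T \<in> bidiff_operators \<Longrightarrow> \<sigma> S = \<sigma> T \<Longrightarrow> S = T"
  using \<sigma> by (auto simp: equivariant_symbol_map_def bij_betw_def dest: inj_onD)

text \<open>Preservation of the principal symbol, read off coefficient by coefficient: in degree at least
  \<open>p + q\<close> the symbol of the operator agrees with its polynomial form.\<close>

lemma symbol_map_principal:
  assumes "c \<noteq> 0" and m: "p + q \<le> monomial_degree m"
  shows "Poly_Mapping.lookup (\<sigma> (axis_operator k p q c)) m =
    Poly_Mapping.lookup (Poly_Mapping.single (axis_monomial k p q) c) m"
proof -
  let ?P = "Poly_Mapping.single (axis_monomial k p q) c"
  let ?T = "axis_operator k p q c"
  have form: "polynomial_form ?T = ?P"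
    by (simp add: axis_operator_eq polynomial_form_bidiff_of_form)
  have order: "total_order ?T = p + q"
    using \<open>c \<noteq> 0\<close> by (simp add: total_order_def form symbol_degree_single monomial_degree_axis_monomial)
  have "?T \<noteq> (\<lambda>f g. 0)"
  proof
    assume "?T = (\<lambda>f g. 0)"
    then have "bidiff_of_form ?P = bidiff_of_form 0"
      by (simp add: axis_operator_eq bidiff_of_form_def)
    then have "?P = 0" by (rule injD[OF inj_bidiff_of_form])
    with \<open>c \<noteq> 0\<close> show False by (metis lookup_single_eq lookup_zero)
  qed
  then have deg: "symbol_degree (\<sigma> ?T) = p + q"
    and hom: "homogeneous_component (p + q) (\<sigma> ?T) = homogeneous_component (p + q) ?P"
    using \<sigma> axis_operator_in[of k p q c]
    by (auto simp: equivariant_symbol_map_def order principal_symbol_def form)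
  show ?thesis
  proof (cases "monomial_degree m = p + q")
    case True
    then show ?thesis
      using arg_cong[OF hom, of "\<lambda>Q. Poly_Mapping.lookup Q m"] by (simp add: lookup_homogeneous_component)
  next
    case False
    then have "axis_monomial k p q \<noteq> m" by (auto simp: monomial_degree_axis_monomial)
    moreover have "Poly_Mapping.lookup (\<sigma> ?T) m = 0"
      using monomial_degree_le_symbol_degree[of "\<sigma> ?T" m] deg m False by force
    ultimately show ?thesis by (simp add: lookup_single)
  qed
qed

text \<open>Rigidity under affine fields.  If \<open>\<sigma>\<close> is known on the operators with differentiated
  coefficients, then translations determine \<open>\<sigma> T\<^sub>c\<close> up to a symbol with constant coefficients.  That
  symbol has degree less than \<open>p + q\<close> by the principal symbol condition, whereas a constant monomial
  of weight \<open>\<delta> - (p + q)\<close> under \<open>x\<^sup>k \<partial>\<^sub>k\<close> has degree at least \<open>p + q\<close>; so it vanishes.\<close>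

lemma symbol_map_axis_operator_step:
  assumes k: "pd k c = 0"
    and derivs: "\<And>j. \<sigma> (axis_operator k p q (pd j c)) = Poly_Mapping.single (axis_monomial k p q) (pd j c)"
  shows "\<sigma> (axis_operator k p q c) = Poly_Mapping.single (axis_monomial k p q) c"
proof (cases "c = 0")
  case True
  then show ?thesis by (simp add: axis_operator_def symbol_map_0)
next
  case False
  let ?\<delta> = "\<mu> - lam\<^sub>1 - lam\<^sub>2"
  let ?T = "axis_operator k p q c"
  let ?P = "Poly_Mapping.single (axis_monomial k p q) c"
  have transl: "deriv_coeffs j (\<sigma> ?T) = deriv_coeffs j ?P" for j
    using symbol_map_lie[OF translation_in_sl axis_operator_in, of j k p q c]
    by (simp add: lie_symbol_translation lie_bidiff_translation_axis_operator derivs deriv_coeffs_single)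
  have "lie_symbol ?\<delta> (linear_field k k) (\<sigma> ?T) = scale_symbol (?\<delta> - real (p + q)) (\<sigma> ?T)"
    using symbol_map_lie[OF linear_field_in_sl axis_operator_in, of k k k p q c]
    by (simp only: lie_bidiff_diagonal_axis_operator[OF k] symbol_map_scaleR axis_operator_in)
  then have weight: "gl_action k k (\<sigma> ?T) = scale_symbol (real (p + q)) (\<sigma> ?T)"
    unfolding lie_symbol_linear_field transl deriv_coeffs_single k
    by (simp add: poly_mapping_eq_iff fun_eq_iff lookup_add lookup_minus lookup_scale_symbol algebra_simps)
  have "Poly_Mapping.lookup (\<sigma> ?T) m = Poly_Mapping.lookup ?P m" for m
  proof (cases "p + q \<le> monomial_degree m")
    case True
    with False show ?thesis by (rule symbol_map_principal)
  next
    case low: False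
    let ?w = "Poly_Mapping.lookup (fst m) k + Poly_Mapping.lookup (snd m) k"
    have "?w \<le> monomial_degree m"
      unfolding monomial_degree_def multi_degree_def by (intro add_mono member_le_sum) auto
    with low have w: "?w < p + q" by simp
    have "real ?w *\<^sub>R Poly_Mapping.lookup (\<sigma> ?T) m = real (p + q) *\<^sub>R Poly_Mapping.lookup (\<sigma> ?T) m"
      using arg_cong[OF weight, of "\<lambda>Q. Poly_Mapping.lookup Q m"]
      by (simp only: lookup_gl_action_diagonal lookup_scale_symbol of_nat_mult_scaleR)
    with w have "Poly_Mapping.lookup (\<sigma> ?T) m = 0"
      by (metis scaleR_cancel_right of_nat_eq_iff less_irrefl)
    moreover have "axis_monomial k p q \<noteq> m"
      using low by (auto simp: monomial_degree_axis_monomial)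
    ultimately show ?thesis by (simp add: lookup_single)
  qed
  then show ?thesis by (rule poly_mapping_eqI)
qed

lemma symbol_map_axis_operator_const:
  "\<sigma> (axis_operator k p q 1) = Poly_Mapping.single (axis_monomial k p q) 1"
proof (rule symbol_map_axis_operator_step)
  show "\<sigma> (axis_operator k p q (pd j 1)) = Poly_Mapping.single (axis_monomial k p q) (pd j 1)" for j
    by (simp add: axis_operator_def symbol_map_0)
qed simp

text \<open>For \<open>i = k\<close> the argument breaks down: \<open>x\<^sup>k m\<close> has the weight of a monomial of degree
  \<open>p + q - 1\<close>, which is where a divergence could enter.\<close>

lemma symbol_map_axis_operator_coord:
  assumes "i \<noteq> k"
  shows "\<sigma> (axis_operator k p q (coord i)) = Poly_Mapping.single (axis_monomial k p q) (coord i)"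
proof (rule symbol_map_axis_operator_step)
  show "pd k (coord i) = 0" using assms by (simp add: pd_coord)
  show "\<sigma> (axis_operator k p q (pd j (coord i))) = Poly_Mapping.single (axis_monomial k p q) (pd j (coord i))" for j
    using symbol_map_axis_operator_const[of k p q] by (simp add: pd_coord axis_operator_def symbol_map_0)
qed

text \<open>The symbols of both sides agree by the identity for the monomial \<open>m\<close>, because \<open>\<sigma>\<close> sends
  \<open>T\<^sub>1\<close> and every \<open>T\<^bsub>x\<^sup>i\<^esub>\<close> with \<open>i \<noteq> k\<close> to their polynomial forms.\<close>

lemma resonant_lie_bidiff_identity:
  fixes k :: 'n
  assumes "p + q = 2" and "(\<mu> - lam\<^sub>1 - lam\<^sub>2) * (real CARD('n) + 1) = real CARD('n) + 3"
  shows "lie_bidiff lam\<^sub>1 lam\<^sub>2 \<mu> (quadratic_field k) (axis_operator k p q 1) =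
    (\<lambda>f g. \<Sum>i\<in>-{k}. lie_bidiff lam\<^sub>1 lam\<^sub>2 \<mu> (linear_field k i) (axis_operator k p q (coord i)) f g)"
proof (rule symbol_map_injective[rotated 2])
  show "\<sigma> (lie_bidiff lam\<^sub>1 lam\<^sub>2 \<mu> (quadratic_field k) (axis_operator k p q 1)) =
    \<sigma> (\<lambda>f g. \<Sum>i\<in>-{k}. lie_bidiff lam\<^sub>1 lam\<^sub>2 \<mu> (linear_field k i) (axis_operator k p q (coord i)) f g)"
    by (simp add: symbol_map_sum lie_bidiff_axis_operator_in symbol_map_lie quadratic_field_in_sl
        linear_field_in_sl axis_operator_in symbol_map_axis_operator_const symbol_map_axis_operator_coord
        lie_symbol_quadratic_field_axis_monomial[OF assms])
qed (intro bidiff_sum lie_bidiff_axis_operator_in)+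

end


section \<open>Two incompatible conditions on the weight \<open>\<lambda>\<^sub>1\<close>\<close>

lemma sum_coord_pd_coord: "(\<Sum>i\<in>UNIV. coord i * pd i (coord k)) = coord k"
  by (simp add: pd_coord if_distrib[of "\<lambda>u. _ * u"] cong: if_cong)

theorem proposition12:
  fixes lam\<^sub>1 lam\<^sub>2 \<mu> :: real
  assumes "CARD('n::finite) \<ge> 2"
    and "\<mu> - lam\<^sub>1 - lam\<^sub>2 = (real CARD('n) + 3) / (real CARD('n) + 1)"
  shows "\<not> (\<exists>\<sigma> :: 'n bioperator \<Rightarrow> 'n symbol. equivariant_symbol_map lam\<^sub>1 lam\<^sub>2 \<mu> \<sigma>)"
proof
  assume "\<exists>\<sigma> :: 'n bioperator \<Rightarrow> 'n symbol. equivariant_symbol_map lam\<^sub>1 lam\<^sub>2 \<mu> \<sigma>"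
  then obtain \<sigma> :: "'n bioperator \<Rightarrow> 'n symbol" where \<sigma>: "equivariant_symbol_map lam\<^sub>1 lam\<^sub>2 \<mu> \<sigma>" ..
  have \<delta>: "(\<mu> - lam\<^sub>1 - lam\<^sub>2) * (real CARD('n) + 1) = real CARD('n) + 3"
    using assms(2) by (simp add: field_simps)
  fix k :: 'n
  let ?N = "real CARD('n) + 1"
  note identity = resonant_lie_bidiff_identity[OF \<sigma> _ \<delta>, THEN fun_cong, THEN fun_cong]
  \<comment> \<open>The test functions are annihilated by the operators themselves and by the right-hand side of the
    identity, so that only one term of the Lie derivative along \<open>x\<^sup>k E\<close> survives.\<close>
  have "1 + lam\<^sub>1 * ?N = 0"
  proof -
    have "lie_density lam\<^sub>1 (quadratic_field k) (coord k) = (1 + lam\<^sub>1 * ?N) *\<^sub>R (coord k * coord k)"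
      by (simp add: lie_density_quadratic_field sum_coord_pd_coord scaleR_add_left)
    then have "lie_bidiff lam\<^sub>1 lam\<^sub>2 \<mu> (quadratic_field k) (axis_operator k 2 0 1) (coord k) 1 =
        - (1 + lam\<^sub>1 * ?N) *\<^sub>R 2"
      by (simp add: lie_bidiff_def axis_operator_def numeral_2_eq_2 pd_scaleR pd_mult pd_coord pd_add
          scaleR_left_diff_distrib scaleR_add_left)
    moreover have "lie_bidiff lam\<^sub>1 lam\<^sub>2 \<mu> (linear_field k i) (axis_operator k 2 0 (coord i)) (coord k) 1 = 0"
      if "i \<noteq> k" for i
      using that
      by (simp add: lie_bidiff_def axis_operator_def numeral_2_eq_2 lie_density_linear_field pd_coord)
    ultimately have "(1 + lam\<^sub>1 * ?N) *\<^sub>R (2 :: 'n smooth_fun) = 0"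
      using identity[of 2 0 k "coord k" 1] by simp
    then show ?thesis by simp
  qed
  moreover have "lam\<^sub>1 * ?N = 0"
  proof -
    have "lie_density lam\<^sub>1 (quadratic_field k) 1 = (lam\<^sub>1 * ?N) *\<^sub>R coord k"
      by (simp add: lie_density_quadratic_field)
    then have "lie_bidiff lam\<^sub>1 lam\<^sub>2 \<mu> (quadratic_field k) (axis_operator k 1 1 1) 1 (coord k) =
        - (lam\<^sub>1 * ?N) *\<^sub>R 1"
      by (simp add: lie_bidiff_def axis_operator_def pd_scaleR pd_coord)
    moreover have "lie_bidiff lam\<^sub>1 lam\<^sub>2 \<mu> (linear_field k i) (axis_operator k 1 1 (coord i)) 1 (coord k) = 0"
      if "i \<noteq> k" for i
      using that by (simp add: lie_bidiff_def axis_operator_def lie_density_linear_field pd_coord)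
    ultimately have "(lam\<^sub>1 * ?N) *\<^sub>R (1 :: 'n smooth_fun) = 0"
      using identity[of 1 1 k 1 "coord k"] by simp
    then show ?thesis by simp
  qed
  ultimately show False by simp
qed

end
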